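(* Let $\mathrm{k}$ be a field of characteristic zero and let $\tilde M_0$ be the infinite matrix with entries $(\tilde M_0)_{ij}=i^{\,j-1}\left(x^i+(-1)^{j}\right)\in\mathrm{k}[x]$, $i,j\ge1$. Then $\tilde M_0$ admits a periodic Gaussian elimination process, with fundamental sequence the lower triangular matrix $T_0$ given by $$(T_0)_{ii}=1,\qquad (T_0)_{i+1,i}=-x-1,\qquad (T_0)_{i+2,i}=x\qquad(i\ge1),$$ all other entries being zero.
   Context: For an infinite matrix $T$ (indexed by $i,j\ge1$), the shifted matrix $s(T)$ is the block diagonal matrix $\begin{pmatrix}1&0\\0&T\end{pmatrix}$ formed by the $1\times1$ identity matrix and $T$. A sequence of infinite matrices $B_k$ converges to $B$ if for every $i,j$ there exists $k_0$ such that $(B_k)_{ij}=B_{ij}$ for all $k\ge k_0$. An infinite matrix $A$ admits a periodic Gaussian elimination process with fundamental sequence $T_0$, where $T_0$ is a lower triangular matrix with $1$'s on the diagonal, if the sequence $A,\ T_0A,\ s(T_0)T_0A,\ s^2(T_0)s(T_0)T_0A,\dots$ converges to an upper triangular matrix. *)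

theory Defs
  imports "HOL-Computational_Algebra.Polynomial"
begin

text \<open>
  Infinite matrices are indexed by positive integers, as functions on \<^typ>\<open>nat\<close>;
  entries with row or column index \<open>0\<close> are not part of the matrix and are ignored
  by all notions below.
\<close>

type_synonym 'a infmat = "nat \<Rightarrow> nat \<Rightarrow> 'a"

text \<open>
  The product is meaningful whenever the left factor is row-finite, in particular when it
  is lower triangular.  If infinitely many entries in row \<open>i\<close> of the left factor are
  nonzero, row \<open>i\<close> of the product is \<open>0\<close> by the library convention for infinite sums.
\<close>

definition infmat_mult :: "'a::comm_ring_1 infmat \<Rightarrow> 'a infmat \<Rightarrow> 'a infmat" where
  "infmat_mult S A = (\<lambda>i j. \<Sum>k | 1 \<le> k \<and> S i k \<noteq> 0. S i k * A k j)"

definition shift_mat :: "'a::comm_ring_1 infmat \<Rightarrow> 'a infmat" where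
  "shift_mat T = (\<lambda>i j. if i = 1 \<and> j = 1 then 1
                        else if 2 \<le> i \<and> 2 \<le> j then T (i - 1) (j - 1)
                        else 0)"

definition lower_unitriangular :: "'a::comm_ring_1 infmat \<Rightarrow> bool" where
  "lower_unitriangular T \<longleftrightarrow>
     (\<forall>i\<ge>1. T i i = 1) \<and> (\<forall>i\<ge>1. \<forall>j\<ge>1. i < j \<longrightarrow> T i j = 0)"

definition upper_triangular_infmat :: "'a::zero infmat \<Rightarrow> bool" where
  "upper_triangular_infmat U \<longleftrightarrow> (\<forall>i\<ge>1. \<forall>j\<ge>1. j < i \<longrightarrow> U i j = 0)"

definition infmat_converges :: "(nat \<Rightarrow> 'a infmat) \<Rightarrow> 'a infmat \<Rightarrow> bool" where
  "infmat_converges B L \<longleftrightarrow> (\<forall>i\<ge>1. \<forall>j\<ge>1. \<exists>k0. \<forall>k\<ge>k0. B k i j = L i j)"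

fun elimination_seq :: "'a::comm_ring_1 infmat \<Rightarrow> 'a infmat \<Rightarrow> nat \<Rightarrow> 'a infmat" where
  "elimination_seq T A 0 = A"
| "elimination_seq T A (Suc n) = infmat_mult ((shift_mat ^^ n) T) (elimination_seq T A n)"

definition periodic_gaussian_elimination :: "'a::comm_ring_1 infmat \<Rightarrow> 'a infmat \<Rightarrow> bool" where
  "periodic_gaussian_elimination A T \<longleftrightarrow>
     lower_unitriangular T \<and>
     (\<exists>U. upper_triangular_infmat U \<and> infmat_converges (elimination_seq T A) U)"

abbreviation polyX :: "'k::comm_ring_1 poly" where
  "polyX \<equiv> monom 1 1"

definition M0_tilde :: "'k::comm_ring_1 poly infmat" where
  "M0_tilde = (\<lambda>i j. of_nat i ^ (j - 1) * (polyX ^ i + (-1) ^ j))"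

definition T0_mat :: "'k::comm_ring_1 poly infmat" where
  "T0_mat = (\<lambda>i j. if i = j then 1
                   else if i = j + 1 then - polyX - 1
                   else if i = j + 2 then polyX
                   else 0)"

end

theory Submission
  imports Defs
begin

text \<open>
  Fix a column \<open>j\<close>.  Re-indexing the rows after step \<open>n\<close> as \<open>n + i\<close> turns the elimination step
  into the fixed operator \<open>g \<mapsto> (\<lambda>i. g (i + 1) - (x + 1) g i + x g (i - 1))\<close>, as long as
  the virtual row \<open>i = 0\<close> is zero.  The original column is \<open>g i = x ^ i * a i - a (- i)\<close> with
  \<open>a i = i ^ (j - 1)\<close>, a shape that vanishes at \<open>0\<close> and is preserved: the step acts on \<open>a\<close> as
  a combination of difference operators.  These lower the degree of \<open>a\<close>, so column \<open>j\<close> vanishes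
  below row \<open>j\<close> after \<open>j\<close> steps.
\<close>

text \<open>The forward difference weighted by \<open>x\<close>, minus the backward difference.
  Integer arguments are used because a row involves \<open>a\<close> at both \<open>i\<close> and
  \<open>- i\<close>.\<close>

definition diff_comb :: "'a::comm_ring_1 \<Rightarrow> (int \<Rightarrow> 'a) \<Rightarrow> int \<Rightarrow> 'a" where
  "diff_comb x a = (\<lambda>i. x * (a (i + 1) - a i) - (a i - a (i - 1)))"

lemma diff_comb_sum:
  "diff_comb x (\<lambda>i. \<Sum>k\<in>K. c k * f k i) = (\<lambda>i. \<Sum>k\<in>K. c k * diff_comb x (f k) i)"
  by (simp add: diff_comb_def sum_distrib_left sum_subtractf sum.distrib algebra_simps)

lemma funpow_diff_comb_sum:
  "(diff_comb x ^^ n) (\<lambda>i. \<Sum>k\<in>K. c k * f k i) = (\<lambda>i. \<Sum>k\<in>K. c k * (diff_comb x ^^ n) (f k) i)"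
  by (induction n) (simp_all add: diff_comb_sum)

lemma shifted_power_diff:
  fixes y h :: "'a::comm_ring_1"
  shows "(y + h) ^ m - y ^ m = (\<Sum>k<m. of_nat (m choose k) * h ^ (m - k) * y ^ k)"
proof -
  have "(y + h) ^ m = (\<Sum>k\<le>m. of_nat (m choose k) * y ^ k * h ^ (m - k))"
    by (rule binomial_ring)
  also have "\<dots> = y ^ m + (\<Sum>k<m. of_nat (m choose k) * y ^ k * h ^ (m - k))"
    by (simp flip: lessThan_Suc_atMost)
  finally show ?thesis
    by (simp add: mult_ac)
qed

text \<open>Binomial expansion with \<open>h = 1\<close> gives the part with \<open>x\<close>, and
  \<open>h = - 1\<close> the part with \<open>(- 1) ^ (m - k)\<close>; the top power cancels in each
  difference.\<close>

lemma diff_comb_power: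
  "diff_comb x (\<lambda>i. of_int i ^ m) =
    (\<lambda>i. \<Sum>k<m. (of_nat (m choose k) * (x + (- 1) ^ (m - k))) * of_int i ^ k)"
proof
  fix i :: int
  show "diff_comb x (\<lambda>i. of_int i ^ m) i =
    (\<Sum>k<m. (of_nat (m choose k) * (x + (- 1) ^ (m - k))) * of_int i ^ k)"
    using shifted_power_diff[of "of_int i :: 'a" 1 m] shifted_power_diff[of "of_int i :: 'a" "-1" m]
    by (simp add: diff_comb_def sum_distrib_left sum.distrib algebra_simps)
qed

lemma funpow_diff_comb_power_eq_0:
  "m < n \<Longrightarrow> (diff_comb x ^^ n) (\<lambda>i. of_int i ^ m) = (\<lambda>_. 0)"
proof (induction n arbitrary: m)
  case (Suc n)
  then show ?case
    \<comment> \<open>The innermost application is peeled off: it leaves powers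
      \<open>k < m\<close>, hence \<open>k < n\<close>, which the other \<open>n\<close>
      applications kill by the induction hypothesis.\<close>
    by (simp add: funpow_Suc_right diff_comb_power funpow_diff_comb_sum del: funpow.simps)
qed simp

lemma funpow_shift_mat:
  assumes "1 \<le> i" "1 \<le> j"
  shows "(shift_mat ^^ n) T i j =
    (if i \<le> n \<or> j \<le> n then (if i = j then 1 else 0) else T (i - n) (j - n))"
  using assms
proof (induction n arbitrary: i j)
  case (Suc n)
  show ?case
  proof (cases "i = 1 \<or> j = 1")
    case False
    with Suc.prems have "2 \<le> i" "2 \<le> j" by auto
    with Suc.IH[of "i - 1" "j - 1"] show ?thesis
      by (auto simp: shift_mat_def)
  qed (use Suc.prems in \<open>auto simp: shift_mat_def\<close>)
qed auto

text \<open>The support summed over in \<open>infmat_mult\<close> depends on which entries vanish; a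
  fixed finite superset \<open>K\<close> spares that case distinction.\<close>

lemma infmat_mult_eq_sum:
  assumes "finite K" "0 \<notin> K" "\<And>k. 1 \<le> k \<Longrightarrow> k \<notin> K \<Longrightarrow> S i k = 0"
  shows "infmat_mult S A i j = (\<Sum>k\<in>K. S i k * A k j)"
proof -
  have "{k. 1 \<le> k \<and> S i k \<noteq> 0} \<subseteq> K"
    using assms(3) by blast
  moreover have "\<forall>k\<in>K. 1 \<le> k"
    using assms(2) by (metis One_nat_def Suc_leI gr0I)
  ultimately show ?thesis
    unfolding infmat_mult_def using assms(1) by (intro sum.mono_neutral_left) auto
qed

text \<open>The first \<open>n + 1\<close> rows of the multiplier are identity rows:
  \<open>n\<close> from the identity block, and one more because the first row of \<open>T\<close>
  is also an identity row.\<close>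

lemma elimination_step_fixed:
  assumes "lower_unitriangular T" "1 \<le> i" "i \<le> Suc n"
  shows "elimination_seq T A (Suc n) i j = elimination_seq T A n i j"
  using infmat_mult_eq_sum[of "{i}" "(shift_mat ^^ n) T" i] assms
  by (auto simp: funpow_shift_mat lower_unitriangular_def le_Suc_eq)

lemma elimination_seq_stable:
  assumes "lower_unitriangular T" "1 \<le> i" "i \<le> Suc n" "n \<le> m"
  shows "elimination_seq T A m i j = elimination_seq T A n i j"
  using assms(4)
proof (induction m rule: dec_induct)
  case (step m)
  then show ?case
    using elimination_step_fixed[of T i m A j] assms(1-3) by simp
qed simp

lemma lower_unitriangular_T0_mat: "lower_unitriangular T0_mat"
  by (auto simp: lower_unitriangular_def T0_mat_def)

text \<open>The second row of \<open>T0_mat\<close> has no entry \<open>polyX\<close>, so this is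
  the general step with zero in place of row \<open>n\<close>.\<close>

lemma elimination_step_T0_mat_second:
  "elimination_seq T0_mat A (Suc n) (n + 2) j =
    elimination_seq T0_mat A n (n + 2) j - (polyX + 1) * elimination_seq T0_mat A n (n + 1) j"
proof -
  have "elimination_seq T0_mat A (Suc n) (n + 2) j =
      (\<Sum>k\<in>{n + 1, n + 2}. (shift_mat ^^ n) T0_mat (n + 2) k * elimination_seq T0_mat A n k j)"
    unfolding elimination_seq.simps
    by (rule infmat_mult_eq_sum) (auto simp: funpow_shift_mat T0_mat_def)
  then show ?thesis
    by (simp add: funpow_shift_mat T0_mat_def algebra_simps)
qed

lemma elimination_step_T0_mat:
  "elimination_seq T0_mat A (Suc n) (n + m + 3) j =
    elimination_seq T0_mat A n (n + m + 3) j
    - (polyX + 1) * elimination_seq T0_mat A n (n + m + 2) j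
    + polyX * elimination_seq T0_mat A n (n + m + 1) j"
proof -
  have "elimination_seq T0_mat A (Suc n) (n + m + 3) j =
      (\<Sum>k\<in>{n + m + 1, n + m + 2, n + m + 3}.
        (shift_mat ^^ n) T0_mat (n + m + 3) k * elimination_seq T0_mat A n k j)"
    unfolding elimination_seq.simps
    by (rule infmat_mult_eq_sum) (auto simp: funpow_shift_mat T0_mat_def)
  then show ?thesis
    by (simp add: funpow_shift_mat T0_mat_def algebra_simps)
qed

lemma elimination_seq_T0_mat_diff_comb:
  assumes "\<And>i. 1 \<le> i \<Longrightarrow> A i j = polyX ^ i * a (int i) - a (- int i)" "1 \<le> i"
  shows "elimination_seq T0_mat A n (n + i) j =
    polyX ^ i * (diff_comb polyX ^^ n) a (int i) - (diff_comb polyX ^^ n) a (- int i)"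
  using assms(2)
proof (induction n arbitrary: i)
  case 0
  then show ?case using assms(1) by simp
next
  case (Suc n)
  define b where "b = (diff_comb polyX ^^ n) a"
  have IH: "elimination_seq T0_mat A n (n + k) j = polyX ^ k * b (int k) - b (- int k)"
    if "1 \<le> k" for k
    using Suc.IH[OF that] by (simp add: b_def)
  have b_Suc: "(diff_comb polyX ^^ Suc n) a = diff_comb polyX b"
    by (simp add: b_def)
  show ?case
  proof (cases "i = 1")
    case True
    have "elimination_seq T0_mat A (Suc n) (Suc n + 1) j =
      elimination_seq T0_mat A n (n + 2) j - (polyX + 1) * elimination_seq T0_mat A n (n + 1) j"
      using elimination_step_T0_mat_second[of A n j] by (simp del: elimination_seq.simps)
    \<comment> \<open>The two terms \<open>polyX * b 0\<close> on the right cancel, which is the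
      vanishing of the virtual row.\<close>
    also have "\<dots> = polyX * diff_comb polyX b 1 - diff_comb polyX b (- 1)"
      unfolding IH[OF one_le_numeral] IH[OF order_refl]
      by (simp add: diff_comb_def algebra_simps power2_eq_square)
    finally show ?thesis
      unfolding True b_Suc by simp
  next
    case False
    with Suc.prems obtain m where m: "i = m + 2"
      by (metis One_nat_def add_2_eq_Suc' le_SucE not0_implies_Suc not_one_le_zero)
    have "elimination_seq T0_mat A (Suc n) (Suc n + i) j =
      elimination_seq T0_mat A n (n + (m + 3)) j
      - (polyX + 1) * elimination_seq T0_mat A n (n + (m + 2)) j
      + polyX * elimination_seq T0_mat A n (n + (m + 1)) j"
      using elimination_step_T0_mat[of A n m j]
      by (simp add: m numeral_3_eq_3 del: elimination_seq.simps)
    also have "\<dots> = polyX ^ (m + 3) * b (int (m + 3)) - b (- int (m + 3))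
      - (polyX + 1) * (polyX ^ (m + 2) * b (int (m + 2)) - b (- int (m + 2)))
      + polyX * (polyX ^ (m + 1) * b (int (m + 1)) - b (- int (m + 1)))"
      by (subst (1 2 3) IH) simp_all
    \<comment> \<open>At positive arguments, factoring out \<open>polyX ^ i\<close> moves the weight
      \<open>polyX\<close> from \<open>i - 1\<close> to \<open>i + 1\<close>; at negative arguments
      the reflection has the same effect, so one operator serves both.\<close>
    also have "\<dots> = polyX ^ i * diff_comb polyX b (int i) - diff_comb polyX b (- int i)"
      by (simp add: m diff_comb_def algebra_simps numeral_3_eq_3)
    finally show ?thesis
      unfolding b_Suc .
  qed
qed

text \<open>The sign \<open>(-1) ^ j\<close> is \<open>- ((-1) ^ (j - 1))\<close>, and the latter
  power is absorbed into that of \<open>- i\<close>.\<close>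

lemma M0_tilde_eq:
  assumes "1 \<le> j"
  shows "M0_tilde i j = polyX ^ i * of_int (int i) ^ (j - 1) - of_int (- int i) ^ (j - 1)"
  using assms by (cases j) (auto simp: M0_tilde_def power_minus[of "of_nat i"] algebra_simps)

theorem mainTheorem6:
  shows "periodic_gaussian_elimination
           (M0_tilde :: 'k::field_char_0 poly infmat) (T0_mat :: 'k poly infmat)"
proof -
  let ?E = "elimination_seq T0_mat (M0_tilde :: 'k poly infmat)"
  \<comment> \<open>Row \<open>i\<close> is final after \<open>i - 1\<close> steps, so the limit is
    read off there. It then has relative index \<open>1\<close>, and since \<open>j < i\<close>
    these steps suffice to kill degree \<open>j - 1\<close>.\<close>
  have "?E (i - 1) i j = 0" if "1 \<le> j" "j < i" for i j
  proof -
    have "?E (i - 1) ((i - 1) + 1) j = 0"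
      using elimination_seq_T0_mat_diff_comb[of "M0_tilde :: 'k poly infmat" j
          "\<lambda>i. of_int i ^ (j - 1)" 1 "i - 1"] M0_tilde_eq[OF that(1), where ?'a = 'k] that
        funpow_diff_comb_power_eq_0[of "j - 1" "i - 1" "polyX :: 'k poly"]
      by simp
    with that show ?thesis by simp
  qed
  then have "upper_triangular_infmat (\<lambda>i. ?E (i - 1) i)"
    by (auto simp: upper_triangular_infmat_def)
  moreover have "infmat_converges ?E (\<lambda>i. ?E (i - 1) i)"
    unfolding infmat_converges_def
    using elimination_seq_stable[OF lower_unitriangular_T0_mat]
    by (metis One_nat_def Suc_pred less_eq_Suc_le order_refl)
  ultimately show ?thesis
    unfolding periodic_gaussian_elimination_def using lower_unitriangular_T0_mat by blast
qed

end
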